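(* Let $\alpha$ and $\beta$ be congruences on a semigroup $S$ with $\alpha\subseteq\beta$, and let $P$ be an arbitrary choice function on the collection of all $\alpha$-classes of $S$. Let $P':S/\alpha\to S/\beta$ be the (surjective) mapping defined by $P'([s]_\alpha)=[s]_\beta$ for every $[s]_\alpha\in S/\alpha$. Then the mapping $\mathcal{F}_{\alpha,\beta}:(a,[s]_\alpha)\mapsto([a]_\beta,[s]_\alpha)$ is a surjective homomorphism of the Rees matrix semigroup $\mathcal{M}(S;S/\alpha;P)$ onto the Rees matrix semigroup $\mathcal{M}(S/\beta;S/\alpha;P')$.
   Context: For a semigroup $S$, a nonempty set $\Lambda$ and a mapping $P:\Lambda\to S$, $\mathcal{M}(S;\Lambda;P)$ denotes the Rees matrix semigroup whose underlying set is $S\times\Lambda$, with multiplication $(s,\lambda)(t,\mu)=(sP(\lambda)t,\mu)$. $[s]_\varrho$ denotes the $\varrho$-class of $s$. A choice function on the collection of all $\alpha$-classes of $S$ is a mapping $P:S/\alpha\to S$ with $P([s]_\alpha)\in[s]_\alpha$ for every $s\in S$. *)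

theory Defs
  imports "HOL-Algebra.Group"
begin

text \<open>
  Semigroups are represented by the records of \<^theory>\<open>HOL-Algebra.Group\<close>, so that the
  homomorphism notions \<^const>\<open>hom\<close> and \<^const>\<open>epi\<close> apply; these depend only on the carrier and
  the multiplication. The field \<^const>\<open>one\<close> plays no role: no assumption is made about it, and
  the records built below leave it undefined. A semigroup is nonempty by convention.
\<close>

locale semigrp =
  fixes S (structure)
  assumes nonempty: "carrier S \<noteq> {}"
    and m_closed: "\<lbrakk>x \<in> carrier S; y \<in> carrier S\<rbrakk> \<Longrightarrow> x \<otimes> y \<in> carrier S"
    and m_assoc: "\<lbrakk>x \<in> carrier S; y \<in> carrier S; z \<in> carrier S\<rbrakk>
      \<Longrightarrow> (x \<otimes> y) \<otimes> z = x \<otimes> (y \<otimes> z)"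

definition semigrp_congruence :: "('a, 'm) monoid_scheme \<Rightarrow> ('a \<times> 'a) set \<Rightarrow> bool"
  where "semigrp_congruence S r \<longleftrightarrow> equiv (carrier S) r \<and>
    (\<forall>a b c d. (a, b) \<in> r \<longrightarrow> (c, d) \<in> r \<longrightarrow> (a \<otimes>\<^bsub>S\<^esub> c, b \<otimes>\<^bsub>S\<^esub> d) \<in> r)"

text \<open>
  The class of \<open>s\<close> is \<open>r `` {s}\<close>, and functions on classes are defined from representatives
  by a union, as in \<^theory>\<open>HOL.Equiv_Relations\<close>: for well-defined functions, all members of
  the union coincide. The lemmas after the definitions give the usual equations.
\<close>

definition quotient_semigrp :: "('a, 'm) monoid_scheme \<Rightarrow> ('a \<times> 'a) set \<Rightarrow> 'a set monoid"
  where "quotient_semigrp S r =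
    \<lparr>carrier = carrier S // r,
     mult = (\<lambda>X Y. \<Union>x\<in>X. \<Union>y\<in>Y. r `` {x \<otimes>\<^bsub>S\<^esub> y}),
     one = undefined\<rparr>"

definition rees_matrix_semigrp ::
    "('a, 'm) monoid_scheme \<Rightarrow> 'l set \<Rightarrow> ('l \<Rightarrow> 'a) \<Rightarrow> ('a \<times> 'l) monoid"
  where "rees_matrix_semigrp S L P =
    \<lparr>carrier = carrier S \<times> L,
     mult = (\<lambda>(s, l) (t, m). (s \<otimes>\<^bsub>S\<^esub> P l \<otimes>\<^bsub>S\<^esub> t, m)),
     one = undefined\<rparr>"

definition class_choice_function ::
    "('a, 'm) monoid_scheme \<Rightarrow> ('a \<times> 'a) set \<Rightarrow> ('a set \<Rightarrow> 'a) \<Rightarrow> bool"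
  where "class_choice_function S r P \<longleftrightarrow>
    P \<in> carrier S // r \<rightarrow> carrier S \<and> (\<forall>s\<in>carrier S. P (r `` {s}) \<in> r `` {s})"

definition class_map :: "('a \<times> 'a) set \<Rightarrow> 'a set \<Rightarrow> 'a set"
  where "class_map r X = (\<Union>s\<in>X. r `` {s})"

definition rees_class_map ::
    "('a, 'm) monoid_scheme \<Rightarrow> ('a \<times> 'a) set \<Rightarrow> ('a \<times> 'a) set \<Rightarrow> 'a \<times> 'a set \<Rightarrow> 'a set \<times> 'a set"
  where "rees_class_map S \<alpha> \<beta> =
    restrict (\<lambda>(a, X). (\<beta> `` {a}, X)) (carrier S \<times> (carrier S // \<alpha>))"

lemma quotient_semigrp_mult:
  assumes "semigrp_congruence S r" "a \<in> carrier S" "b \<in> carrier S"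
  shows "r `` {a} \<otimes>\<^bsub>quotient_semigrp S r\<^esub> r `` {b} = r `` {a \<otimes>\<^bsub>S\<^esub> b}"
proof -
  have eq: "equiv (carrier S) r" using assms(1) by (simp add: semigrp_congruence_def)
  have "(\<lambda>x y. r `` {x \<otimes>\<^bsub>S\<^esub> y}) respects2 r"
    using assms(1) by (intro congruent2I' equiv_class_eq[OF eq]) (simp add: semigrp_congruence_def)
  from UN_equiv_class2[OF eq eq this assms(2,3)] show ?thesis
    by (simp add: quotient_semigrp_def)
qed

lemma class_map_class:
  assumes "equiv A \<alpha>" "equiv A \<beta>" "\<alpha> \<subseteq> \<beta>" "s \<in> A"
  shows "class_map \<beta> (\<alpha> `` {s}) = \<beta> `` {s}"
proof -
  have "(\<lambda>s. \<beta> `` {s}) respects \<alpha>"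
    using assms(3) by (intro congruentI equiv_class_eq[OF assms(2)]) auto
  from UN_equiv_class[OF assms(1) this assms(4)] show ?thesis
    by (simp add: class_map_def)
qed

end

theory Submission
  imports Defs
begin

text \<open>
  The matrix of \<open>M(S/\<beta>; S/\<alpha>; P')\<close> is the image of the matrix \<open>P\<close> under the canonical
  epimorphism \<open>s \<mapsto> [s]\<^sub>\<beta>\<close>: the element chosen by \<open>P\<close> from an \<open>\<alpha>\<close>-class \<open>X\<close> lies in \<open>X\<close>, and
  \<open>\<alpha> \<subseteq> \<beta>\<close> forces its \<open>\<beta>\<close>-class to be the one \<open>\<beta>\<close>-class containing \<open>X\<close>, that is \<open>P' X\<close>
  (\<open>class_map_eq_class_of_choice\<close>). The choice of the representative is therefore invisible modulo
  \<open>\<beta>\<close>. The rest is functoriality of the Rees matrix construction with a fixed index set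
  (\<open>rees_matrix_epi\<close>): an epimorphism \<open>f : S \<rightarrow> T\<close> acting on the first coordinate is an
  epimorphism \<open>M(S; L; P) \<rightarrow> M(T; L; f \<circ> P)\<close>.
\<close>

lemma semigrp_rees_matrix:
  assumes "semigrp S" "L \<noteq> {}" "P \<in> L \<rightarrow> carrier S"
  shows "semigrp (rees_matrix_semigrp S L P)"
proof -
  interpret semigrp S by fact
  have P: "P l \<in> carrier S" if "l \<in> L" for l using assms(3) that by auto
  show ?thesis
    by unfold_locales
      (use nonempty assms(2) in \<open>auto simp: rees_matrix_semigrp_def m_closed m_assoc P\<close>)
qed

lemma rees_matrix_epi:
  assumes S: "semigrp S"
    and P: "P \<in> L \<rightarrow> carrier S"
    and f: "f \<in> epi S T"
    and Q: "\<And>l. l \<in> L \<Longrightarrow> Q l = f (P l)"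
  shows "restrict (\<lambda>(a, l). (f a, l)) (carrier S \<times> L)
    \<in> epi (rees_matrix_semigrp S L P) (rees_matrix_semigrp T L Q)"
proof -
  interpret semigrp S by fact
  have PS: "P l \<in> carrier S" if "l \<in> L" for l using P that by auto
  have mult: "f (x \<otimes>\<^bsub>S\<^esub> y) = f x \<otimes>\<^bsub>T\<^esub> f y" if "x \<in> carrier S" "y \<in> carrier S" for x y
    using f that by (simp add: epi_def hom_def)
  have img: "f ` carrier S = carrier T" using f by (simp add: epi_def)
  have "(\<lambda>(a, l). (f a, l)) ` (carrier S \<times> L) = carrier T \<times> L"
    unfolding img[symmetric] by force
  then show ?thesis
    using img by (auto simp: epi_def hom_def rees_matrix_semigrp_def Q PS mult m_closed)
qed

lemma class_hom_epi:
  assumes "semigrp_congruence S r"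
  shows "(\<lambda>a. r `` {a}) \<in> epi S (quotient_semigrp S r)"
proof -
  have "carrier (quotient_semigrp S r) = (\<lambda>a. r `` {a}) ` carrier S"
    by (auto simp: quotient_semigrp_def quotient_def)
  then show ?thesis
    using quotient_semigrp_mult[OF assms] by (auto simp: epi_def hom_def)
qed

text \<open>
  Semigroup laws pass to homomorphic images. Hence \<open>M(S/\<beta>; S/\<alpha>; P')\<close> is a semigroup because
  \<open>M(S; S/\<alpha>; P)\<close> is, without any computation with classes.
\<close>

lemma semigrp_epi_image:
  assumes S: "semigrp S" and f: "f \<in> epi S T"
  shows "semigrp T"
proof -
  interpret semigrp S by fact
  have mult: "f x \<otimes>\<^bsub>T\<^esub> f y = f (x \<otimes>\<^bsub>S\<^esub> y)" if "x \<in> carrier S" "y \<in> carrier S" for x y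
    using f that by (simp add: epi_def hom_def)
  have img: "carrier T = f ` carrier S" using f by (simp add: epi_def)
  show ?thesis
    by unfold_locales (use nonempty in \<open>auto simp: img mult m_closed m_assoc\<close>)
qed

lemma class_map_image_quotient:
  assumes "equiv A \<alpha>" "equiv A \<beta>" "\<alpha> \<subseteq> \<beta>"
  shows "class_map \<beta> ` (A // \<alpha>) = A // \<beta>"
proof -
  have classes: "A // r = (\<lambda>s. r `` {s}) ` A" for r :: "('a \<times> 'a) set"
    by (auto simp: quotient_def)
  show ?thesis
    unfolding classes image_image
    using class_map_class[OF assms] by simp
qed

text \<open>
  This is where the choice property and \<open>\<alpha> \<subseteq> \<beta>\<close> meet: a chosen representative is
  \<open>\<alpha>\<close>-related, hence \<open>\<beta>\<close>-related, to every other one.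
\<close>

lemma class_map_eq_class_of_choice:
  assumes \<alpha>: "equiv (carrier S) \<alpha>" and \<beta>: "equiv (carrier S) \<beta>" and sub: "\<alpha> \<subseteq> \<beta>"
    and P: "class_choice_function S \<alpha> P"
    and X: "X \<in> carrier S // \<alpha>"
  shows "class_map \<beta> X = \<beta> `` {P X}"
proof -
  obtain s where s: "s \<in> carrier S" "X = \<alpha> `` {s}"
    using X by (auto elim: quotientE)
  then have "(s, P X) \<in> \<beta>"
    using P sub by (auto simp: class_choice_function_def)
  then show ?thesis
    using class_map_class[OF \<alpha> \<beta> sub s(1)] equiv_class_eq[OF \<beta>] s(2) by simp
qed

theorem lemma1:
  fixes S :: "('a, 'm) monoid_scheme"
    and \<alpha> \<beta> :: "('a \<times> 'a) set"
    and P :: "'a set \<Rightarrow> 'a"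
  assumes "semigrp S"
    and "semigrp_congruence S \<alpha>"
    and "semigrp_congruence S \<beta>"
    and "\<alpha> \<subseteq> \<beta>"
    and "class_choice_function S \<alpha> P"
  shows "(\<forall>s\<in>carrier S. class_map \<beta> (\<alpha> `` {s}) = \<beta> `` {s}) \<and>
    class_map \<beta> ` (carrier S // \<alpha>) = carrier S // \<beta> \<and>
    semigrp (rees_matrix_semigrp S (carrier S // \<alpha>) P) \<and>
    semigrp (rees_matrix_semigrp (quotient_semigrp S \<beta>) (carrier S // \<alpha>) (class_map \<beta>)) \<and>
    rees_class_map S \<alpha> \<beta> \<in>
      epi (rees_matrix_semigrp S (carrier S // \<alpha>) P)
          (rees_matrix_semigrp (quotient_semigrp S \<beta>) (carrier S // \<alpha>) (class_map \<beta>))"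
proof -
  have \<alpha>: "equiv (carrier S) \<alpha>" and \<beta>: "equiv (carrier S) \<beta>"
    using assms(2,3) by (simp_all add: semigrp_congruence_def)
  have P: "P \<in> carrier S // \<alpha> \<rightarrow> carrier S"
    using assms(5) by (simp add: class_choice_function_def)
  have ne: "carrier S // \<alpha> \<noteq> {}"
    using semigrp.nonempty[OF assms(1)] by (simp add: quotient_def)
  have rees: "semigrp (rees_matrix_semigrp S (carrier S // \<alpha>) P)"
    by (rule semigrp_rees_matrix[OF assms(1) ne P])
  have epi: "rees_class_map S \<alpha> \<beta> \<in>
      epi (rees_matrix_semigrp S (carrier S // \<alpha>) P)
          (rees_matrix_semigrp (quotient_semigrp S \<beta>) (carrier S // \<alpha>) (class_map \<beta>))"
    unfolding rees_class_map_def
    by (rule rees_matrix_epi[OF assms(1) P class_hom_epi[OF assms(3)]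
          class_map_eq_class_of_choice[OF \<alpha> \<beta> assms(4,5)]])
  show ?thesis
    using class_map_class[OF \<alpha> \<beta> assms(4)] class_map_image_quotient[OF \<alpha> \<beta> assms(4)]
      rees semigrp_epi_image[OF rees epi] epi
    by blast
qed

end
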